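(* Let $N\ge 1$, let $\Omega\subset\mathbb{R}^N$ be a non-empty, open, bounded domain with Lipschitz boundary, let $\mathcal{C}:=\Omega\times(0,\infty)\subset\mathbb{R}^{N+1}$, and let $s:\Omega\to\mathbb{R}$ be measurable with $s(x)\in[0,1]$ for almost all $x\in\Omega$. Suppose that for some $x_0\in\Omega$ and some $q>0$ there exist positive constants $R_0,M_0,m_0$ such that $$m_0|x-x_0|^q\le s(x)\le M_0|x-x_0|^q$$ for all $x$ such that $|x-x_0|\le R_0$. Then $w\notin A_2(\mathcal{C})$, where $w(x,y):=y^{1-2s(x)}$ for $(x,y)\in\mathcal{C}$.
   Context: A weight $w>0$ on $\mathcal{C}$ belongs to the Muckenhoupt class $A_2(\mathcal{C})$ if there is a constant $M>0$ such that $$\left(\frac{1}{|Q|}\int_{Q}w\,dx\,dy\right)\left(\frac{1}{|Q|}\int_{Q}w^{-1}\,dx\,dy\right)\le M$$ for all open cubes $Q\subset\mathcal{C}$, where $|Q|$ denotes Lebesgue measure (integrals of the non-negative functions $w$, $w^{-1}$ may take the value $+\infty$, in which case the inequality fails for that $Q$). *)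

theory Defs
  imports "HOL-Analysis.Analysis"
begin

text \<open>
  Locally, after a rigid change of coordinates, \<open>\<Omega>\<close> is the region strictly above the graph of a
  Lipschitz function. The unit vector \<open>u\<close> is the vertical direction; the graph function \<open>\<gamma>\<close> lives
  on the hyperplane orthogonal to \<open>u\<close>, which stands for \<open>\<real>\<^bsup>N-1\<^esup>\<close> (a single point if \<open>N = 1\<close>).
\<close>

definition lipschitz_boundary :: "'a::euclidean_space set \<Rightarrow> bool" where
  "lipschitz_boundary \<Omega> \<longleftrightarrow>
    (\<forall>p\<in>frontier \<Omega>. \<exists>r>0. \<exists>u. norm u = 1 \<and>
      (\<exists>\<gamma> :: 'a \<Rightarrow> real. (\<exists>L. L-lipschitz_on {v. v \<bullet> u = 0} \<gamma>) \<and>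
        \<Omega> \<inter> ball p r = {x \<in> ball p r. \<gamma> (x - (x \<bullet> u) *\<^sub>R u) < x \<bullet> u}))"

definition open_cube :: "'a::euclidean_space set \<Rightarrow> bool" where
  "open_cube Q \<longleftrightarrow> (\<exists>a l. l > 0 \<and> Q = box a (a + (\<Sum>i\<in>Basis. l *\<^sub>R i)))"

definition average_on :: "'a::euclidean_space set \<Rightarrow> ('a \<Rightarrow> real) \<Rightarrow> ennreal" where
  "average_on Q f = (\<integral>\<^sup>+z\<in>Q. ennreal (f z) \<partial>lebesgue) / emeasure lebesgue Q"

definition weight_on :: "'a::euclidean_space set \<Rightarrow> ('a \<Rightarrow> real) \<Rightarrow> bool" where
  "weight_on C w \<longleftrightarrow> w \<in> borel_measurable (lebesgue_on C) \<and> (\<forall>z\<in>C. w z > 0)"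

text \<open>
  The averages are extended non-negative reals. For a weight both are strictly positive, so the
  product is \<open>\<infinity>\<close>, and the bound fails, as soon as one of the integrals is infinite; the convention
  \<open>0 * \<infinity> = 0\<close> does not come into play.
\<close>

definition muckenhoupt_A2 :: "'a::euclidean_space set \<Rightarrow> ('a \<Rightarrow> real) set" where
  "muckenhoupt_A2 C = {w. weight_on C w \<and>
    (\<exists>M::real. M > 0 \<and> (\<forall>Q. open_cube Q \<and> Q \<subseteq> C \<longrightarrow>
      average_on Q w * average_on Q (\<lambda>z. inverse (w z)) \<le> ennreal M))}"

text \<open>The function of interest is a weight, so only the \<open>A\<^sub>2\<close> bound can fail for it.\<close>

lemma weight_on_power:
  fixes s :: "'a::euclidean_space \<Rightarrow> real"
  assumes "open \<Omega>" and s: "s \<in> borel_measurable (lebesgue_on \<Omega>)"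
  shows "weight_on (\<Omega> \<times> {0<..}) (\<lambda>(x, y). y powr (1 - 2 * s x))"
proof -
  have \<Omega>: "\<Omega> \<in> sets lebesgue"
    using assms by auto
  have "(\<lambda>x. if x \<in> \<Omega> then s x else 0) \<in> borel_measurable lebesgue"
    using s \<Omega> by (rule borel_measurable_if_I)
  then obtain g where g [measurable]: "g \<in> borel_measurable lborel"
    and ae: "AE x in lborel. (if x \<in> \<Omega> then s x else 0) = g x"
    using completion_ex_borel_measurable_real by blast
  from ae obtain N where N: "N \<in> null_sets lborel"
    and sg: "\<And>x. x \<notin> N \<Longrightarrow> (if x \<in> \<Omega> then s x else 0) = g x"
    by (auto elim!: AE_E3)
  have N2: "N \<times> (UNIV :: real set) \<in> null_sets (lborel :: ('a \<times> real) measure)"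
    using lborel.times_in_null_sets1[OF N, of "UNIV :: real set"] by (simp add: lborel_prod)
  define h where "h = (\<lambda>z :: 'a \<times> real. snd z powr (1 - 2 * g (fst z)))"
  define k where "k = (\<lambda>z :: 'a \<times> real. snd z powr (1 - 2 * (if fst z \<in> \<Omega> then s (fst z) else 0)))"
  have "h \<in> borel_measurable (lborel \<Otimes>\<^sub>M lborel)"
    unfolding h_def by measurable
  then have h: "h \<in> borel_measurable lebesgue"
    by (simp add: lborel_prod measurable_completion)
  have "AE z in lborel. h z = k z"
  proof (rule AE_I'[OF N2], rule subsetI)
    fix z assume "z \<in> {z \<in> space lborel. h z \<noteq> k z}"
    then have "fst z \<in> N"
      using sg[of "fst z"] by (cases "fst z \<in> N") (simp_all only: h_def k_def mem_Collect_eq, simp_all)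
    then show "z \<in> N \<times> UNIV"
      by (cases z) simp
  qed
  then have "AE z in lebesgue. h z = k z"
    by (rule AE_completion)
  with h have "k \<in> borel_measurable lebesgue"
    by (rule borel_measurable_AE)
  then have "k \<in> borel_measurable (lebesgue_on (\<Omega> \<times> {0<..}))"
    by (rule measurable_restrict_space1)
  then have "(\<lambda>(x, y). y powr (1 - 2 * s x)) \<in> borel_measurable (lebesgue_on (\<Omega> \<times> {0<..}))"
    by (subst measurable_cong[where g = k]) (auto simp: k_def)
  then show ?thesis
    by (auto simp: weight_on_def)
qed

end

theory Submission
  imports Defs "HOL-Real_Asymp.Real_Asymp"
begin

text \<open>
  Test the \<open>A\<^sub>2\<close> bound on the cubes \<open>Q = D \<times> (0, l)\<close> with \<open>D\<close> centred at \<open>x0\<close> and \<open>l \<rightarrow> 0\<close>. On \<open>D\<close>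
  we have \<open>0 \<le> s \<le> \<sigma>\<close> with \<open>\<sigma>\<close> proportional to \<open>l\<^sup>q\<close>, so for \<open>l \<le> 1\<close> the weight is at least \<open>y\<close>, with
  average \<open>l / 2\<close>, and its inverse is at least \<open>y\<close> to the power \<open>2 \<sigma> - 1\<close>, with average
  \<open>l\<close> to the power \<open>2 \<sigma> - 1\<close> divided by \<open>2 \<sigma>\<close>. The product of the averages is therefore at least
  \<open>l\<close> to the power \<open>2 \<sigma>\<close> divided by \<open>4 \<sigma>\<close>, which tends to infinity since \<open>\<sigma> ln l \<rightarrow> 0\<close>.
\<close>

lemma average_on_mono:
  assumes "\<And>z. z \<in> Q \<Longrightarrow> f z \<le> g z"
  shows "average_on Q f \<le> average_on Q g"
  unfolding average_on_def using assms
  by (intro divide_right_mono_ennreal nn_integral_mono) (auto simp: indicator_def ennreal_leI)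

lemma nn_integral_powr_from_0:
  fixes a l :: real
  assumes "a > -1" and "l > 0"
  shows "(\<integral>\<^sup>+y\<in>{0<..<l}. ennreal (y powr a) \<partial>lborel) = ennreal (l powr (a + 1) / (a + 1))"
proof -
  have "((\<lambda>y. y powr a) has_integral (l powr (a + 1) / (a + 1))) {0<..<l}"
    using has_integral_powr_from_0[of a l] assms
    by (simp add: has_integral_Icc_iff_Ioo)
  then show ?thesis
    by (intro nn_integral_has_integral_lebesgue') auto
qed

lemma average_on_snd_powr:
  fixes D :: "'a::euclidean_space set" and a l :: real
  assumes [measurable]: "D \<in> sets borel" and D: "emeasure lborel D \<noteq> 0" "emeasure lborel D \<noteq> \<infinity>"
    and a: "a > -1" and l: "l > 0"
  shows "average_on (D \<times> {0<..<l}) (\<lambda>z. snd z powr a) = ennreal (l powr a / (a + 1))"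
proof -
  let ?Q = "D \<times> {0<..<l}" and ?I = "ennreal (l powr (a + 1) / (a + 1))"
  have Q_sets [measurable]: "?Q \<in> sets (lborel \<Otimes>\<^sub>M lborel)"
    by (intro pair_measureI) auto
  have meas: "(\<lambda>z. ennreal (snd z powr a) * indicator ?Q z) \<in> borel_measurable (lborel \<Otimes>\<^sub>M lborel)"
    by measurable
  have "(\<integral>\<^sup>+z\<in>?Q. ennreal (snd z powr a) \<partial>lebesgue)
      = (\<integral>\<^sup>+z\<in>?Q. ennreal (snd z powr a) \<partial>(lborel \<Otimes>\<^sub>M lborel))"
    by (simp add: nn_integral_completion lborel_prod)
  also have "\<dots> = (\<integral>\<^sup>+x. (\<integral>\<^sup>+y. ennreal (y powr a) * indicator ?Q (x, y) \<partial>lborel) \<partial>lborel)"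
    using lborel.nn_integral_fst[OF meas] by simp
  also have "\<dots> = (\<integral>\<^sup>+x. ?I * indicator D x \<partial>lborel)"
  proof (rule nn_integral_cong)
    fix x :: 'a
    have "(\<integral>\<^sup>+y. ennreal (y powr a) * indicator ?Q (x, y) \<partial>lborel)
        = (\<integral>\<^sup>+y. (ennreal (y powr a) * indicator {0<..<l} y) * indicator D x \<partial>lborel)"
      by (auto intro!: nn_integral_cong simp: indicator_def)
    then show "(\<integral>\<^sup>+y. ennreal (y powr a) * indicator ?Q (x, y) \<partial>lborel) = ?I * indicator D x"
      by (simp add: nn_integral_multc nn_integral_powr_from_0[OF a l])
  qed
  also have "\<dots> = ?I * emeasure lborel D"
    by (simp add: nn_integral_cmult_indicator)
  \<comment> \<open>Splitting off one factor \<open>l\<close> exposes the measure of the whole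
    cylinder, ready to cancel.\<close>
  also have "?I = ennreal (l powr a / (a + 1)) * ennreal l"
    using a l by (simp add: powr_add flip: ennreal_mult)
  finally have I: "(\<integral>\<^sup>+z\<in>?Q. ennreal (snd z powr a) \<partial>lebesgue)
      = ennreal (l powr a / (a + 1)) * (emeasure lborel D * ennreal l)"
    by (simp add: mult_ac)
  have "emeasure lebesgue ?Q = emeasure (lborel \<Otimes>\<^sub>M lborel) ?Q"
    using Q_sets unfolding lborel_prod by simp
  also have "\<dots> = emeasure lborel D * ennreal l"
    using l by (subst lborel.emeasure_pair_measure_Times) auto
  finally have Q: "emeasure lebesgue ?Q = emeasure lborel D * ennreal l" .
  show ?thesis
    unfolding average_on_def I Q
    by (rule mult_divide_eq_ennreal) (use D l in \<open>auto simp: ennreal_mult_eq_top_iff\<close>)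
qed

text \<open>The new cube has lower vertex \<open>(a, 0)\<close>: it rests on the bottom face y = 0,
  where the weight degenerates.\<close>

lemma open_cube_Times:
  fixes a :: "'a::euclidean_space"
  assumes "l > 0"
  shows "open_cube (box a (a + (\<Sum>i\<in>Basis. l *\<^sub>R i)) \<times> {0<..<l::real})"
proof -
  have "(\<Sum>i\<in>Basis. l *\<^sub>R i) = (\<Sum>i\<in>Basis. l *\<^sub>R i :: 'a, l)"
    by (simp add: sum_Basis_prod_eq prod_eq_iff fst_sum snd_sum)
  then have "box a (a + (\<Sum>i\<in>Basis. l *\<^sub>R i)) \<times> {0<..<l}
      = box (a, 0) ((a, 0) + (\<Sum>i\<in>Basis. l *\<^sub>R i))"
    by (simp add: box_prod[of "(a, 0)"])
  with assms show ?thesis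
    unfolding open_cube_def by blast
qed

text \<open>The l1 norm dominates the Euclidean one. The constant is crude, but only a bound
  proportional to \<open>l\<close> matters.\<close>

lemma norm_diff_centre_le:
  fixes x c :: "'a::euclidean_space" and l :: real
  assumes "x \<in> box (c - (\<Sum>i\<in>Basis. (l / 2) *\<^sub>R i)) (c - (\<Sum>i\<in>Basis. (l / 2) *\<^sub>R i) + (\<Sum>i\<in>Basis. l *\<^sub>R i))"
  shows "norm (x - c) \<le> DIM('a) * l"
proof -
  have "\<bar>(x - c) \<bullet> i\<bar> \<le> l" if "i \<in> Basis" for i
    using assms that unfolding mem_box
    by (force simp: inner_diff_left inner_add_left)
  then have "(\<Sum>i\<in>Basis. \<bar>(x - c) \<bullet> i\<bar>) \<le> DIM('a) * l"
    by (rule sum_bounded_above)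
  then show ?thesis
    using norm_le_l1[of "x - c"] by linarith
qed

theorem proposition2p1:
  fixes \<Omega> :: "(real ^ 'n) set"
    and s :: "real ^ 'n \<Rightarrow> real"
    and x0 :: "real ^ 'n"
    and q R0 M0 m0 :: real
  assumes "\<Omega> \<noteq> {}" and "open \<Omega>" and "connected \<Omega>" and "bounded \<Omega>"
    and "lipschitz_boundary \<Omega>"
    and "s \<in> borel_measurable (lebesgue_on \<Omega>)"
    and "AE x in lebesgue_on \<Omega>. 0 \<le> s x \<and> s x \<le> 1"
    and "x0 \<in> \<Omega>" and "q > 0"
    and "R0 > 0" and "M0 > 0" and "m0 > 0"
    and "\<And>x. x \<in> \<Omega> \<Longrightarrow> norm (x - x0) \<le> R0 \<Longrightarrow>
           m0 * norm (x - x0) powr q \<le> s x \<and> s x \<le> M0 * norm (x - x0) powr q"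
  shows "(\<lambda>(x, y). y powr (1 - 2 * s x)) \<notin> muckenhoupt_A2 (\<Omega> \<times> {0<..})"
proof
  let ?w = "\<lambda>(x, y). y powr (1 - 2 * s x)"
  assume "?w \<in> muckenhoupt_A2 (\<Omega> \<times> {0<..})"
  then obtain M :: real where "M > 0"
    and A2: "\<And>Q. open_cube Q \<Longrightarrow> Q \<subseteq> \<Omega> \<times> {0<..} \<Longrightarrow>
      average_on Q ?w * average_on Q (\<lambda>z. inverse (?w z)) \<le> ennreal M"
    unfolding muckenhoupt_A2_def by blast
  obtain e where "e > 0" and e: "cball x0 e \<subseteq> \<Omega>"
    using \<open>open \<Omega>\<close> \<open>x0 \<in> \<Omega>\<close> open_contains_cball by blast
  define k where "k = real DIM(real ^ 'n)"
  have "k > 0"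
    unfolding k_def by simp
  \<comment> \<open>On \<open>D\<close> the distance to \<open>x0\<close> is at most
    \<open>k * l\<close>, so the upper bound on \<open>s\<close> becomes M0 (k l)^q = c l^q.\<close>
  define c where "c = M0 * k powr q"
  have "c > 0"
    using \<open>k > 0\<close> \<open>M0 > 0\<close> by (simp add: c_def)
  \<comment> \<open>The numerator is exp (2 c l^q ln l), which tends to 1, while the denominator
    tends to 0 from above.\<close>
  have "filterlim (\<lambda>l. l powr (2 * (c * l powr q)) / (4 * (c * l powr q))) at_top (at_right 0)"
    using \<open>c > 0\<close> \<open>q > 0\<close> by real_asymp
  then have "\<forall>\<^sub>F l in at_right 0. M < l powr (2 * (c * l powr q)) / (4 * (c * l powr q))"
    by (simp add: filterlim_at_top_dense)
  \<comment> \<open>Three constraints: l < 1 makes powers of y < l decrease in the exponent, k l < e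
    keeps \<open>D\<close> inside \<open>\<Omega>\<close>, and k l < R0 gives access to the bounds
    on \<open>s\<close>.\<close>
  moreover have "\<forall>\<^sub>F l in at_right 0. 0 < l \<and> l < min 1 (min e R0 / k)"
    using eventually_at_right_real[of 0 "min 1 (min e R0 / k)"] \<open>e > 0\<close> \<open>R0 > 0\<close> \<open>k > 0\<close>
    by (auto elim!: eventually_mono)
  ultimately have "\<forall>\<^sub>F l in at_right 0. M < l powr (2 * (c * l powr q)) / (4 * (c * l powr q))
      \<and> 0 < l \<and> l < min 1 (min e R0 / k)"
    by eventually_elim simp
  then obtain l where big: "M < l powr (2 * (c * l powr q)) / (4 * (c * l powr q))"
    and l: "0 < l" "l < min 1 (min e R0 / k)"
    using eventually_happens[of _ "at_right (0::real)"] by auto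
  define \<sigma> where "\<sigma> = c * l powr q"
  have "\<sigma> > 0"
    using \<open>c > 0\<close> \<open>l > 0\<close> by (simp add: \<sigma>_def)
  define a where "a = x0 - (\<Sum>i\<in>Basis. (l / 2) *\<^sub>R i)"
  define D where "D = box a (a + (\<Sum>i\<in>Basis. l *\<^sub>R i))"
  have kl: "k * l \<le> e" "k * l \<le> R0"
    using l \<open>k > 0\<close> by (auto simp: field_simps)
  have near: "norm (x - x0) \<le> k * l" if "x \<in> D" for x
    using norm_diff_centre_le that unfolding D_def a_def k_def by blast
  have in_\<Omega>: "x \<in> \<Omega>" if "x \<in> D" for x
    using near[OF that] kl e by (auto simp: dist_norm norm_minus_commute)
  have s: "0 \<le> s x \<and> s x \<le> \<sigma>" if "x \<in> D" for x
  proof -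
    have "m0 * norm (x - x0) powr q \<le> s x" and "s x \<le> M0 * norm (x - x0) powr q"
      using assms(13)[OF in_\<Omega>[OF that]] near[OF that] kl by auto
    \<comment> \<open>The lower bound with \<open>m0\<close> yields \<open>0 \<le> s x\<close> at
      every point of \<open>D\<close>, not merely almost everywhere.\<close>
    moreover have "0 \<le> m0 * norm (x - x0) powr q"
      using \<open>m0 > 0\<close> by simp
    moreover have "M0 * norm (x - x0) powr q \<le> M0 * (k * l) powr q"
      using near[OF that] \<open>M0 > 0\<close> \<open>q > 0\<close> by (intro mult_left_mono powr_mono2) auto
    moreover have "M0 * (k * l) powr q = \<sigma>"
      using \<open>k > 0\<close> \<open>l > 0\<close> by (simp add: \<sigma>_def c_def powr_mult)
    ultimately show ?thesis by linarith
  qed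
  have "emeasure lborel D = ennreal (\<Prod>i\<in>(Basis :: (real ^ 'n) set). l)"
    unfolding D_def using \<open>l > 0\<close> by (subst emeasure_lborel_box) (auto simp: inner_add_left)
  then have D: "D \<in> sets borel" "emeasure lborel D \<noteq> 0" "emeasure lborel D \<noteq> \<infinity>"
    using \<open>l > 0\<close> by (auto simp: D_def)
  let ?Q = "D \<times> {0<..<l}"
  have "average_on ?Q (\<lambda>z. snd z powr 1) \<le> average_on ?Q ?w"
  proof (rule average_on_mono, clarify)
    fix x y assume "x \<in> D" "y \<in> {0<..<l}"
    then show "snd (x, y) powr 1 \<le> y powr (1 - 2 * s x)"
      using s[of x] l by (simp only: snd_conv) (intro powr_mono'; auto)
  qed
  \<comment> \<open>Inverting the weight flips its exponent to 2 s - 1, at most 2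
    \<open>\<sigma>\<close> - 1, and the base y is below 1.\<close>
  moreover have "average_on ?Q (\<lambda>z. snd z powr (2 * \<sigma> - 1)) \<le> average_on ?Q (\<lambda>z. inverse (?w z))"
  proof (rule average_on_mono, clarify)
    fix x y assume "x \<in> D" "y \<in> {0<..<l}"
    then show "snd (x, y) powr (2 * \<sigma> - 1) \<le> inverse (y powr (1 - 2 * s x))"
      using s[of x] l by (simp only: snd_conv powr_minus[symmetric]) (intro powr_mono'; auto)
  qed
  ultimately have "average_on ?Q (\<lambda>z. snd z powr 1) * average_on ?Q (\<lambda>z. snd z powr (2 * \<sigma> - 1))
      \<le> average_on ?Q ?w * average_on ?Q (\<lambda>z. inverse (?w z))"
    by (rule mult_mono) auto
  also have "\<dots> \<le> ennreal M"
    using open_cube_Times[OF \<open>l > 0\<close>, of a] in_\<Omega> by (intro A2) (auto simp: D_def)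
  also have "average_on ?Q (\<lambda>z. snd z powr 1) = ennreal (l powr 1 / (1 + 1))"
    by (rule average_on_snd_powr[OF D]) (use \<open>l > 0\<close> in auto)
  \<comment> \<open>Since \<open>\<sigma> > 0\<close>, the exponent exceeds -1 and the integral is
    finite; its closeness to -1 produces the large factor 1 / (2 \<open>\<sigma>\<close>).\<close>
  also have "average_on ?Q (\<lambda>z. snd z powr (2 * \<sigma> - 1))
      = ennreal (l powr (2 * \<sigma> - 1) / (2 * \<sigma> - 1 + 1))"
    by (rule average_on_snd_powr[OF D]) (use \<open>l > 0\<close> \<open>\<sigma> > 0\<close> in auto)
  also have "ennreal (l powr 1 / (1 + 1)) * ennreal (l powr (2 * \<sigma> - 1) / (2 * \<sigma> - 1 + 1))
      = ennreal (l powr (2 * \<sigma>) / (4 * \<sigma>))"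
    using \<open>l > 0\<close> \<open>\<sigma> > 0\<close> by (simp add: powr_diff flip: ennreal_mult)
  finally have "l powr (2 * \<sigma>) / (4 * \<sigma>) \<le> M"
    using \<open>M > 0\<close> by (simp add: ennreal_le_iff)
  with big show False
    by (simp add: \<sigma>_def)
qed

end
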